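(* Let $(g_k)_{k=1}^K$ be a frame of $\mathbb{C}^m$, $(f_k)_{k=1}^K$ a frame of $\mathbb{C}^n$, and let $T$ be an arbitrary complex $m\times n$ matrix. Define the lower symbol $\sigma_L\in\mathbb{C}^K$ by $(\sigma_L)_k=\langle Tf_k,g_k\rangle_{\mathbb{C}^m}$ and the $K\times K$ matrix $G_{\mathcal{HS}}$ by $$(G_{\mathcal{HS}})_{l,k}=\langle g_k,g_l\rangle\cdot\langle f_l,f_k\rangle .$$ Then $G_{\mathcal{HS}}$ is the Gram matrix of $(g_k\otimes\overline{f}_k)_{k=1}^K$ with respect to the Frobenius inner product, i.e. $(G_{\mathcal{HS}})_{l,k}=\langle g_k\otimes\overline{f}_k,g_l\otimes\overline{f}_l\rangle_{\mathcal{HS}}$, and, setting $\sigma=G_{\mathcal{HS}}^{\dagger}\sigma_L$ (with $\dagger$ the Moore–Penrose pseudoinverse), the matrix $$T_A=\sum_{k=1}^K\sigma_k\,g_k\otimes\overline{f}_k$$ is the best approximation of $T$ in the Frobenius norm by a frame multiplier for these frames; that is, $T_A$ is the orthogonal projection of $T$ onto $V=\mathrm{span}\{g_k\otimes\overline{f}_k: k=1,\dots,K\}$.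
   Context: Inner products on $\mathbb{C}^p$ are linear in the first argument. A frame of $\mathbb{C}^p$ is a sequence $(x_k)$ with $A\|x\|^2\le\sum_k|\langle x,x_k\rangle|^2\le B\|x\|^2$ for all $x$, for some $A,B>0$. $g\otimes\overline{f}$ denotes the operator $x\mapsto\langle x,f\rangle g$, whose matrix has entries $g_i\overline{f_j}$. The Frobenius (Hilbert–Schmidt) inner product on complex $m\times n$ matrices is $\langle A,B\rangle_{\mathcal{HS}}=\sum_{i,j}A_{i,j}\overline{B_{i,j}}$, with associated Frobenius norm. A frame multiplier for the frames $(g_k)$ and $(f_k)$ is an operator of the form $\sum_{k}m_k\,g_k\otimes\overline{f}_k$, i.e. $x\mapsto\sum_k m_k\langle x,f_k\rangle g_k$, with $m\in\mathbb{C}^K$ (the upper symbol). *)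

theory Defs
  imports "HOL-Analysis.Analysis"
begin

text \<open>The library inner product on \<^typ>\<open>complex^'n\<close> is the real one, \<open>\<Sum>i. Re (x$i * cnj (y$i))\<close>;
  the complex-valued inner product, linear in the first argument, is introduced here.
  It induces the library norm of \<^typ>\<open>complex^'n\<close> (lemma \<open>cinner_self\<close>).\<close>

definition cinner :: "complex^'n \<Rightarrow> complex^'n \<Rightarrow> complex" where
  "cinner x y = (\<Sum>i\<in>UNIV. x $ i * cnj (y $ i))"

lemma cinner_self: "cinner x x = complex_of_real ((norm x)\<^sup>2)"
  by (simp add: cinner_def norm_vec_def L2_set_def sum_nonneg complex_norm_square
      del: of_real_power)

definition is_frame :: "('k::finite \<Rightarrow> complex^'n) \<Rightarrow> bool" where
  "is_frame x \<longleftrightarrow> (\<exists>A B. 0 < A \<and> 0 < B \<and>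
     (\<forall>v. A * (norm v)\<^sup>2 \<le> (\<Sum>k\<in>UNIV. (cmod (cinner v (x k)))\<^sup>2) \<and>
          (\<Sum>k\<in>UNIV. (cmod (cinner v (x k)))\<^sup>2) \<le> B * (norm v)\<^sup>2))"

text \<open>An \<open>m \<times> n\<close> matrix has type \<^typ>\<open>complex^'n^'m\<close>, with entries \<open>A $ i $ j\<close>. The next function
  is the scalar multiplication that makes these matrices a complex vector space.\<close>

definition cmat_scale :: "complex \<Rightarrow> complex^'n^'m \<Rightarrow> complex^'n^'m" where
  "cmat_scale c A = (\<chi> i j. c * A $ i $ j)"

global_interpretation cmat: vector_space "cmat_scale :: complex \<Rightarrow> complex^'n^'m \<Rightarrow> complex^'n^'m"
  by unfold_locales (simp_all add: cmat_scale_def vec_eq_iff algebra_simps)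

definition hs_inner :: "complex^'n^'m \<Rightarrow> complex^'n^'m \<Rightarrow> complex" where
  "hs_inner A B = (\<Sum>i\<in>UNIV. \<Sum>j\<in>UNIV. A $ i $ j * cnj (B $ i $ j))"

definition hs_norm :: "complex^'n^'m \<Rightarrow> real" where
  "hs_norm A = sqrt (Re (hs_inner A A))"

lemma hs_norm_eq_norm: "hs_norm A = norm A"
  by (simp add: hs_norm_def hs_inner_def norm_vec_def L2_set_def sum_nonneg
      complex_norm_square [symmetric] del: of_real_power)

definition rank_one :: "complex^'m \<Rightarrow> complex^'n \<Rightarrow> complex^'n^'m" where
  "rank_one y x = (\<chi> i j. y $ i * cnj (x $ j))"

lemma rank_one_mult_vec: "rank_one y x *v v = cinner v x *s y"
  by (simp add: rank_one_def cinner_def matrix_vector_mult_def vec_eq_iff sum_distrib_left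
      sum_distrib_right mult_ac)

definition frame_multiplier ::
    "('k::finite \<Rightarrow> complex^'m) \<Rightarrow> ('k \<Rightarrow> complex^'n) \<Rightarrow> complex^'k \<Rightarrow> complex^'n^'m" where
  "frame_multiplier g f s = (\<Sum>k\<in>UNIV. cmat_scale (s $ k) (rank_one (g k) (f k)))"

lemma frame_multiplier_mult_vec:
  "frame_multiplier g f s *v v = (\<Sum>k\<in>UNIV. (s $ k * cinner v (f k)) *s g k)"
proof -
  have scale: "cmat_scale c A *v w = c *s (A *v w)" for c w and A :: "complex^'b^'a"
    by (simp add: cmat_scale_def matrix_vector_mult_def vec_eq_iff sum_distrib_left mult_ac)
  have "(\<Sum>k\<in>S. cmat_scale (s $ k) (rank_one (g k) (f k))) *v v
      = (\<Sum>k\<in>S. (s $ k * cinner v (f k)) *s g k)" if "finite S" for S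
    using that
    by induction (simp_all add: matrix_vector_mult_add_rdistrib scale rank_one_mult_vec)
  then show ?thesis
    by (simp add: frame_multiplier_def)
qed

definition lower_symbol ::
    "complex^'n^'m \<Rightarrow> ('k::finite \<Rightarrow> complex^'m) \<Rightarrow> ('k \<Rightarrow> complex^'n) \<Rightarrow> complex^'k" where
  "lower_symbol T g f = (\<chi> k. cinner (T *v f k) (g k))"

definition hs_gram ::
    "('k::finite \<Rightarrow> complex^'m) \<Rightarrow> ('k \<Rightarrow> complex^'n) \<Rightarrow> complex^'k^'k" where
  "hs_gram g f = (\<chi> l k. cinner (g k) (g l) * cinner (f l) (f k))"

definition conj_transpose :: "complex^'n^'m \<Rightarrow> complex^'m^'n" where
  "conj_transpose A = (\<chi> i j. cnj (A $ j $ i))"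

definition is_moore_penrose_inverse :: "complex^'n^'m \<Rightarrow> complex^'m^'n \<Rightarrow> bool" where
  "is_moore_penrose_inverse A X \<longleftrightarrow>
     A ** X ** A = A \<and> X ** A ** X = X \<and>
     conj_transpose (A ** X) = A ** X \<and> conj_transpose (X ** A) = X ** A"

definition pinv :: "complex^'n^'m \<Rightarrow> complex^'m^'n" where
  "pinv A = (THE X. is_moore_penrose_inverse A X)"

definition is_hs_orthogonal_projection ::
    "(complex^'n^'m) set \<Rightarrow> complex^'n^'m \<Rightarrow> complex^'n^'m \<Rightarrow> bool" where
  "is_hs_orthogonal_projection V T P \<longleftrightarrow> P \<in> V \<and> (\<forall>M\<in>V. hs_inner (T - P) M = 0)"

text \<open>\<open>P\<close> is the unique element of \<open>S\<close> nearest to \<open>T\<close> in the Frobenius norm.\<close>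

definition is_best_hs_approximation ::
    "(complex^'n^'m) set \<Rightarrow> complex^'n^'m \<Rightarrow> complex^'n^'m \<Rightarrow> bool" where
  "is_best_hs_approximation S T P \<longleftrightarrow>
     P \<in> S \<and> (\<forall>M\<in>S. M \<noteq> P \<longrightarrow> hs_norm (T - P) < hs_norm (T - M))"

end

(* A matrix A has a pseudoinverse because complex matrices have inner inverses and A* A M = A* A N
   forces A M = A N.  Let s be the lower symbol and e = s - G (pinv G) s.  As G is Hermitian,
   G (pinv G) is an orthogonal projection that fixes G, so G e = 0; hence
   |sum_k e_k r_k|^2 = <G e, e> = 0 for the rank-one matrices r_k.  On the other hand
   e_k = <T - T_A, r_k>, so |e|^2 = <T - T_A, sum_k e_k r_k> = 0: the residual T - T_A is
   orthogonal to every r_k, although the r_k may be linearly dependent. *)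
theory Submission
  imports Defs
begin

section \<open>Moore-Penrose inverses of complex matrices\<close>

lemma conj_transpose_conj_transpose [simp]: "conj_transpose (conj_transpose A) = A"
  by (simp add: conj_transpose_def vec_eq_iff)

lemma conj_transpose_mult: "conj_transpose (A ** B) = conj_transpose B ** conj_transpose A"
  by (simp add: conj_transpose_def matrix_matrix_mult_def vec_eq_iff mult.commute)

text \<open>The diagonal entries of \<open>conj_transpose A ** A\<close> are the squared norms of
  the columns of \<open>A\<close>.\<close>

lemma conj_transpose_mult_self_eq_0:
  assumes "conj_transpose A ** A = 0"
  shows "A = 0"
proof -
  have "A $ j $ i = 0" for i j
  proof -
    have "(conj_transpose A ** A) $ i $ i = complex_of_real (\<Sum>j\<in>UNIV. (cmod (A $ j $ i))\<^sup>2)"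
      by (simp add: conj_transpose_def matrix_matrix_mult_def complex_norm_square mult.commute
          del: of_real_power)
    then have "(\<Sum>j\<in>UNIV. (cmod (A $ j $ i))\<^sup>2) = 0"
      using assms by (metis of_real_eq_0_iff zero_index)
    then show ?thesis
      by (simp add: sum_nonneg_eq_0_iff)
  qed
  then show ?thesis
    by (simp add: vec_eq_iff)
qed

lemma matrix_diff_ldistrib: "A ** (B - C) = A ** B - A ** (C :: 'a::ring_1^'n^'m)"
  by (simp add: matrix_matrix_mult_def vec_eq_iff sum_subtractf right_diff_distrib)

text \<open>With D = \<open>A ** (M - N)\<close>, multiplying the hypothesis by the adjoint of
  \<open>M - N\<close> yields D* D = 0, hence D = 0.\<close>

lemma conj_transpose_mult_self_cancel:
  assumes "conj_transpose A ** A ** M = conj_transpose A ** A ** N"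
  shows "A ** M = A ** N"
proof -
  have "conj_transpose A ** (A ** (M - N)) = 0"
    using assms by (simp add: matrix_diff_ldistrib matrix_mul_assoc)
  then have "conj_transpose (A ** (M - N)) ** (A ** (M - N)) = 0"
    by (simp add: conj_transpose_mult flip: matrix_mul_assoc)
  then show ?thesis
    using conj_transpose_mult_self_eq_0 by (metis eq_iff_diff_eq_0 matrix_diff_ldistrib)
qed

text \<open>Take for \<open>X\<close> the matrix of a linear map that chooses preimages under
  \<open>A\<close> for the vectors in its range.\<close>

lemma ex_inner_inverse:
  fixes A :: "'a::field^'n^'m"
  obtains X where "A ** X ** A = A"
proof -
  obtain h where h: "Vector_Spaces.linear (*s) (*s) h" "\<forall>v\<in>range ((*v) A). A *v h v = v"
    using vec.linear_exists_right_inverse_on[OF matrix_vector_mul_linear_gen vec.subspace_UNIV]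
    by blast
  have "A ** matrix h ** A = A"
    by (simp add: matrix_eq matrix_works[OF h(1)] h(2) flip: matrix_vector_mul_assoc)
  then show thesis
    by (rule that)
qed

text \<open>The witness comes from the normal equations: an inner inverse \<open>Y\<close> of A* A,
  followed by A* on its right. It inverts \<open>A\<close> because A* can be cancelled from A*
  A.\<close>

lemma ex_inner_inverse_hermitian:
  fixes A :: "complex^'n^'m"
  obtains X where "A ** X ** A = A" and "conj_transpose (A ** X) = A ** X"
proof -
  obtain Y where Y: "conj_transpose A ** A ** Y ** (conj_transpose A ** A) = conj_transpose A ** A"
    using ex_inner_inverse by blast
  let ?X = "Y ** conj_transpose A"
  have inner: "A ** ?X ** A = A"
    using conj_transpose_mult_self_cancel[of A "?X ** A" "mat 1"] Y
    by (simp add: matrix_mul_assoc)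
  then have "conj_transpose A = conj_transpose A ** conj_transpose (A ** ?X)"
    by (metis conj_transpose_mult)
  \<comment> \<open>Multiply on the left by \<open>A ** Y\<close>. The right-hand side now has the
    form B B*, which is visibly Hermitian.\<close>
  then have "A ** ?X = A ** ?X ** conj_transpose (A ** ?X)"
    by (metis matrix_mul_assoc)
  then have "conj_transpose (A ** ?X) = A ** ?X"
    by (metis conj_transpose_mult conj_transpose_conj_transpose)
  with inner show thesis
    by (rule that)
qed

text \<open>One inner inverse \<open>U\<close> makes \<open>A ** U\<close> Hermitian, and another
  one \<open>V\<close>, obtained from the adjoint of \<open>A\<close>, makes \<open>V ** A\<close>
  Hermitian. The product \<open>V ** A ** U\<close> inherits both properties.\<close>

lemma ex_moore_penrose_inverse: "\<exists>X. is_moore_penrose_inverse A X"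
proof -
  obtain U where U: "A ** U ** A = A" "conj_transpose (A ** U) = A ** U"
    by (rule ex_inner_inverse_hermitian)
  obtain W where W: "conj_transpose A ** W ** conj_transpose A = conj_transpose A"
      "conj_transpose (conj_transpose A ** W) = conj_transpose A ** W"
    by (rule ex_inner_inverse_hermitian)
  define V where "V = conj_transpose W"
  have V: "A ** V ** A = A" "conj_transpose (V ** A) = V ** A"
    using W unfolding V_def
    by (metis conj_transpose_mult conj_transpose_conj_transpose matrix_mul_assoc)+
  let ?X = "V ** A ** U"
  have AX: "A ** ?X = A ** U" and XA: "?X ** A = V ** A"
    using U(1) V(1) by (metis matrix_mul_assoc)+
  have "?X ** A ** ?X = ?X"
    using V(1) XA by (metis matrix_mul_assoc)
  then have "is_moore_penrose_inverse A ?X"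
    using U V by (simp add: is_moore_penrose_inverse_def AX XA)
  then show ?thesis ..
qed

text \<open>\<open>A ** X\<close> and \<open>A ** Y\<close> are Hermitian idempotents, each
  absorbing the other, so taking adjoints identifies them; likewise \<open>X ** A\<close> and
  \<open>Y ** A\<close>. Then X = XAX = XAY = YAY = Y.\<close>

lemma moore_penrose_inverse_unique:
  assumes "is_moore_penrose_inverse A X" and "is_moore_penrose_inverse A Y"
  shows "X = Y"
proof -
  have X: "A ** X ** A = A" "X ** A ** X = X"
      "conj_transpose (A ** X) = A ** X" "conj_transpose (X ** A) = X ** A"
    and Y: "A ** Y ** A = A" "Y ** A ** Y = Y"
      "conj_transpose (A ** Y) = A ** Y" "conj_transpose (Y ** A) = Y ** A"
    using assms by (simp_all add: is_moore_penrose_inverse_def)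
  have "A ** X = conj_transpose (A ** Y ** (A ** X))"
    using X(3) Y(1) by (metis matrix_mul_assoc)
  also have "\<dots> = A ** X ** (A ** Y)"
    using X(3) Y(3) by (metis conj_transpose_mult)
  also have "\<dots> = A ** Y"
    using X(1) by (metis matrix_mul_assoc)
  finally have AX: "A ** X = A ** Y" .
  have "X ** A = conj_transpose (X ** A ** (Y ** A))"
    using X(4) Y(1) by (metis matrix_mul_assoc)
  also have "\<dots> = Y ** A ** (X ** A)"
    using X(4) Y(4) by (metis conj_transpose_mult)
  also have "\<dots> = Y ** A"
    using X(1) by (metis matrix_mul_assoc)
  finally have XA: "X ** A = Y ** A" .
  show ?thesis
    using X(2) Y(2) AX XA by (metis matrix_mul_assoc)
qed

lemma is_moore_penrose_inverse_pinv: "is_moore_penrose_inverse A (pinv A)"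
  unfolding pinv_def
  using ex_moore_penrose_inverse moore_penrose_inverse_unique by (metis theI)

text \<open>For Hermitian \<open>A\<close>, the adjoint of \<open>A ** pinv A ** A = A\<close> reads
  \<open>A ** (A ** pinv A) = A\<close>.\<close>

lemma hermitian_mult_pinv_residual:
  assumes "conj_transpose A = A"
  shows "A *v (s - A *v (pinv A *v s)) = 0"
proof -
  have mp: "A ** pinv A ** A = A" "conj_transpose (A ** pinv A) = A ** pinv A"
    using is_moore_penrose_inverse_pinv[of A] by (simp_all add: is_moore_penrose_inverse_def)
  have "A ** (A ** pinv A) = conj_transpose (A ** pinv A ** A)"
    using assms mp(2) by (metis conj_transpose_mult)
  then have "A ** (A ** pinv A) = A"
    using assms mp(1) by simp
  then show ?thesis
    by (simp add: matrix_vector_mult_diff_distrib matrix_vector_mul_assoc)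
qed

section \<open>The Frobenius inner product\<close>

lemma hs_inner_diff_left: "hs_inner (A - B) C = hs_inner A C - hs_inner B C"
  by (simp add: hs_inner_def sum_subtractf left_diff_distrib)

lemma hs_inner_add_left: "hs_inner (A + B) C = hs_inner A C + hs_inner B C"
  by (simp add: hs_inner_def sum.distrib distrib_right)

lemma hs_inner_scale_left: "hs_inner (cmat_scale c A) B = c * hs_inner A B"
  by (simp add: hs_inner_def cmat_scale_def sum_distrib_left mult.assoc)

lemma cnj_hs_inner: "cnj (hs_inner A B) = hs_inner B A"
  by (simp add: hs_inner_def mult.commute)

lemma hs_inner_sum_left: "hs_inner (\<Sum>k\<in>S. F k) B = (\<Sum>k\<in>S. hs_inner (F k) B)"
  by (induction S rule: infinite_finite_induct)
     (simp_all add: hs_inner_add_left, simp_all add: hs_inner_def)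

lemma hs_inner_frame_multiplier_left:
  "hs_inner (frame_multiplier g f s) B = (\<Sum>k\<in>UNIV. s $ k * hs_inner (rank_one (g k) (f k)) B)"
  by (simp add: frame_multiplier_def hs_inner_sum_left hs_inner_scale_left)

lemma hs_inner_frame_multiplier_right:
  "hs_inner B (frame_multiplier g f s) =
    (\<Sum>k\<in>UNIV. cnj (s $ k) * hs_inner B (rank_one (g k) (f k)))"
proof -
  have "hs_inner B (frame_multiplier g f s) = cnj (hs_inner (frame_multiplier g f s) B)"
    by (simp add: cnj_hs_inner)
  also have "\<dots> = (\<Sum>k\<in>UNIV. cnj (s $ k) * hs_inner B (rank_one (g k) (f k)))"
    by (simp add: hs_inner_frame_multiplier_left cnj_hs_inner)
  finally show ?thesis .
qed

lemma hs_inner_self: "hs_inner A A = complex_of_real ((hs_norm A)\<^sup>2)"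
proof -
  have "hs_inner A A = complex_of_real (\<Sum>i\<in>UNIV. \<Sum>j\<in>UNIV. (cmod (A $ i $ j))\<^sup>2)"
    by (simp add: hs_inner_def complex_norm_square del: of_real_power)
  then show ?thesis
    by (simp add: hs_norm_def sum_nonneg)
qed

lemma hs_inner_self_eq_0: "hs_inner A A = 0 \<longleftrightarrow> A = 0"
  by (simp add: hs_inner_self hs_norm_eq_norm)

text \<open>This turns the lower symbol into the list of Frobenius inner products of
  \<open>T\<close> with the rank-one matrices.\<close>

lemma hs_inner_rank_one_right: "hs_inner T (rank_one y x) = cinner (T *v x) y"
  by (simp add: hs_inner_def rank_one_def cinner_def matrix_vector_mult_def sum_distrib_left mult_ac)

lemma hs_inner_rank_one: "hs_inner (rank_one y x) (rank_one v u) = cinner y v * cinner u x"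
  by (simp add: hs_inner_rank_one_right rank_one_mult_vec)
     (simp add: cinner_def sum_distrib_left mult_ac)

text \<open>The form is conjugate-linear in its second slot; for a zero set the slots may be
  exchanged, which makes linearity available.\<close>

lemma subspace_hs_orthogonal: "cmat.subspace {M. hs_inner A M = 0}"
proof -
  have "{M. hs_inner A M = 0} = {M. hs_inner M A = 0}"
    by (metis cnj_hs_inner complex_cnj_zero)
  also have "cmat.subspace \<dots>"
    by (auto simp: cmat.subspace_def hs_inner_add_left hs_inner_scale_left)
       (simp add: hs_inner_def)
  finally show ?thesis .
qed

text \<open>Pythagoras for \<open>T - M = (T - P) + (P - M)\<close>. As \<open>S\<close> may be
  smaller than \<open>V\<close>, the multipliers only have to lie in the span.\<close>

lemma hs_orthogonal_projection_imp_best_approximation: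
  assumes proj: "is_hs_orthogonal_projection V T P" and V: "cmat.subspace V"
    and S: "S \<subseteq> V" "P \<in> S"
  shows "is_best_hs_approximation S T P"
  unfolding is_best_hs_approximation_def
proof (intro conjI ballI impI)
  fix M
  assume M: "M \<in> S" "M \<noteq> P"
  let ?A = "T - P" and ?B = "P - M"
  have "?B \<in> V"
    using M S V by (auto intro: cmat.subspace_diff)
  then have AB: "hs_inner ?A ?B = 0"
    using proj by (simp add: is_hs_orthogonal_projection_def)
  then have BA: "hs_inner ?B ?A = 0"
    by (metis cnj_hs_inner complex_cnj_zero)
  have "hs_inner (T - M) (T - M) = hs_inner ?A (?A + ?B) + hs_inner ?B (?A + ?B)"
    by (simp flip: hs_inner_add_left)
  also have "\<dots> = cnj (hs_inner (?A + ?B) ?A) + cnj (hs_inner (?A + ?B) ?B)"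
    by (simp only: cnj_hs_inner)
  also have "\<dots> = hs_inner ?A ?A + hs_inner ?B ?B"
    by (simp only: hs_inner_add_left AB BA complex_cnj_add cnj_hs_inner add_0_left add_0_right)
  finally have "(hs_norm (T - M))\<^sup>2 = (hs_norm ?A)\<^sup>2 + (hs_norm ?B)\<^sup>2"
    unfolding hs_inner_self by (metis of_real_add of_real_eq_iff)
  moreover have "0 < (hs_norm ?B)\<^sup>2"
    using M by (simp add: hs_norm_eq_norm)
  ultimately have "(hs_norm ?A)\<^sup>2 < (hs_norm (T - M))\<^sup>2"
    by linarith
  then show "hs_norm ?A < hs_norm (T - M)"
    by (rule power2_less_imp_less) (simp add: hs_norm_eq_norm)
qed (use S in simp)

section \<open>Frame multipliers\<close>

lemma hs_gram_eq_hs_inner: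
  "hs_gram g f $ l $ k = hs_inner (rank_one (g k) (f k)) (rank_one (g l) (f l))"
  by (simp add: hs_gram_def hs_inner_rank_one)

lemma lower_symbol_eq_hs_inner: "lower_symbol T g f $ k = hs_inner T (rank_one (g k) (f k))"
  by (simp add: lower_symbol_def hs_inner_rank_one_right)

lemma conj_transpose_hs_gram: "conj_transpose (hs_gram g f) = hs_gram g f"
  by (simp add: conj_transpose_def vec_eq_iff hs_gram_eq_hs_inner cnj_hs_inner)

text \<open>The Gram matrix sends an upper symbol to the lower symbol of the multiplier it
  defines.\<close>

lemma hs_gram_mult_vec:
  "(hs_gram g f *v s) $ l = hs_inner (frame_multiplier g f s) (rank_one (g l) (f l))"
  by (simp add: matrix_vector_mult_def hs_gram_eq_hs_inner hs_inner_frame_multiplier_left mult.commute)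

lemma frame_multiplier_in_span:
  "frame_multiplier g f s \<in> cmat.span (range (\<lambda>k. rank_one (g k) (f k)))"
  unfolding frame_multiplier_def
  by (intro cmat.span_sum cmat.span_scale cmat.span_base) simp

text \<open>The kernel of the Gram matrix consists of the linear dependencies among the rank-one
  matrices: a multiplier orthogonal to all of them is orthogonal to itself.\<close>

lemma frame_multiplier_eq_0_iff: "frame_multiplier g f s = 0 \<longleftrightarrow> hs_gram g f *v s = 0"
proof
  assume "frame_multiplier g f s = 0"
  then show "hs_gram g f *v s = 0"
    by (simp add: vec_eq_iff hs_gram_mult_vec) (simp add: hs_inner_def)
next
  assume "hs_gram g f *v s = 0"
  then have "hs_inner (frame_multiplier g f s) (rank_one (g l) (f l)) = 0" for l
    by (simp flip: hs_gram_mult_vec)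
  then have "hs_inner (frame_multiplier g f s) (frame_multiplier g f s) = 0"
    by (subst hs_inner_frame_multiplier_right) simp
  then show "frame_multiplier g f s = 0"
    by (simp add: hs_inner_self_eq_0)
qed

lemma frame_multiplier_pinv_residual_orthogonal:
  assumes "P = frame_multiplier g f (pinv (hs_gram g f) *v lower_symbol T g f)"
  shows "hs_inner (T - P) (rank_one (g k) (f k)) = 0"
proof -
  define e where "e = lower_symbol T g f -
    hs_gram g f *v (pinv (hs_gram g f) *v lower_symbol T g f)"
  have e: "e $ k = hs_inner (T - P) (rank_one (g k) (f k))" for k
    unfolding e_def assms
    by (simp add: hs_gram_mult_vec lower_symbol_eq_hs_inner hs_inner_diff_left)
  have "hs_gram g f *v e = 0"
    unfolding e_def by (rule hermitian_mult_pinv_residual[OF conj_transpose_hs_gram])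
  \<comment> \<open>The multiplier with symbol \<open>e\<close> is itself the zero matrix.\<close>
  then have "hs_inner (T - P) (frame_multiplier g f e) = 0"
    by (simp add: hs_inner_def flip: frame_multiplier_eq_0_iff)
  \<comment> \<open>Expanding the second slot pairs each \<open>cnj (e $ k)\<close> with the
    coefficient of the residual, which is \<open>e $ k\<close> again.\<close>
  then have "cinner e e = 0"
    unfolding hs_inner_frame_multiplier_right
    by (simp add: cinner_def mult.commute flip: e)
  then have "e = 0"
    by (simp add: cinner_self)
  then show ?thesis
    by (simp flip: e)
qed

lemma frame_multiplier_pinv_orthogonal_projection:
  assumes "P = frame_multiplier g f (pinv (hs_gram g f) *v lower_symbol T g f)"
  shows "is_hs_orthogonal_projection (cmat.span (range (\<lambda>k. rank_one (g k) (f k)))) T P"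
proof -
  \<comment> \<open>Orthogonality to the generators passes to their span because the orthogonal
    complement is a subspace.\<close>
  have "cmat.span (range (\<lambda>k. rank_one (g k) (f k))) \<subseteq> {M. hs_inner (T - P) M = 0}"
    using frame_multiplier_pinv_residual_orthogonal[OF assms]
    by (intro cmat.span_minimal subspace_hs_orthogonal) auto
  then show ?thesis
    unfolding is_hs_orthogonal_projection_def by (auto simp: assms frame_multiplier_in_span)
qed

theorem mainTheorem4:
  fixes g :: "'k::finite \<Rightarrow> complex^'m"
    and f :: "'k \<Rightarrow> complex^'n"
    and T T_A :: "complex^'n^'m"
    and \<sigma> :: "complex^'k"
  assumes "is_frame g" and "is_frame f"
    and "\<sigma> = pinv (hs_gram g f) *v lower_symbol T g f"
    and "T_A = (\<Sum>k\<in>UNIV. cmat_scale (\<sigma> $ k) (rank_one (g k) (f k)))"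
  shows "(\<forall>l k. hs_gram g f $ l $ k = hs_inner (rank_one (g k) (f k)) (rank_one (g l) (f l))) \<and>
    is_best_hs_approximation (range (frame_multiplier g f)) T T_A \<and>
    is_hs_orthogonal_projection (cmat.span (range (\<lambda>k. rank_one (g k) (f k)))) T T_A"
proof -
  let ?V = "cmat.span (range (\<lambda>k. rank_one (g k) (f k)))"
  have T_A: "T_A = frame_multiplier g f (pinv (hs_gram g f) *v lower_symbol T g f)"
    using assms(3,4) by (simp add: frame_multiplier_def)
  have proj: "is_hs_orthogonal_projection ?V T T_A"
    using T_A by (rule frame_multiplier_pinv_orthogonal_projection)
  have "is_best_hs_approximation (range (frame_multiplier g f)) T T_A"
    using proj cmat.subspace_span
  proof (rule hs_orthogonal_projection_imp_best_approximation)
    show "range (frame_multiplier g f) \<subseteq> ?V"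
      using frame_multiplier_in_span by auto
    show "T_A \<in> range (frame_multiplier g f)"
      by (simp add: T_A)
  qed
  with proj show ?thesis
    by (simp add: hs_gram_eq_hs_inner)
qed

end
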